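(* Let $p\ge 1$, $q\ge 0$ be integers, let $\alpha_1,\dots,\alpha_p>0$, $\beta_1,\dots,\beta_q>0$, and let $A_1,\dots,A_p\ge 0$, $B_1,\dots,B_q\ge 0$ be such that $\epsilon=1+\sum_{l=1}^q B_l-\sum_{l=1}^p A_l>0$. For $a>0$ let $$\Psi(a;z)={}_p\Psi_q\Big[\begin{matrix}(a,A_1),(\alpha_2,A_2),\dots,(\alpha_p,A_p)\\ (\beta_1,B_1),\dots,(\beta_q,B_q)\end{matrix}\Big|z\Big]$$ be the Fox-Wright function in which the first numerator parameter equals $a$. Then for all $z\in(0,\infty)$ $$\Psi(\alpha_1;z)\,\Psi(\alpha_1+2;z)-\big(\Psi(\alpha_1+1;z)\big)^2>0.$$
   Context: The Fox-Wright function is $${}_p\Psi_q\Big[\begin{matrix}(\alpha_1,A_1),\dots,(\alpha_p,A_p)\\ (\beta_1,B_1),\dots,(\beta_q,B_q)\end{matrix}\Big|z\Big]=\sum_{k=0}^\infty\frac{\prod_{l=1}^p\Gamma(\alpha_l+kA_l)}{\prod_{l=1}^q\Gamma(\beta_l+kB_l)}\frac{z^k}{k!},$$ where $A_l\ge0$, $B_l\ge0$; the series converges for all $z\in\mathbb{C}$ when $\epsilon=1+\sum_{l=1}^qB_l-\sum_{l=1}^pA_l>0$. *)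

theory Defs
  imports "HOL-Analysis.Analysis"
begin

text \<open>
  The parameter families are indexed by \<open>1, \<dots>, p\<close> and \<open>1, \<dots>, q\<close>; values of the functions
  outside these ranges are irrelevant, and an empty product (\<open>q = 0\<close>) is 1. The sum is meaningful
  only where the series converges, in particular for every \<open>z\<close> if
  \<open>1 + (\<Sum>l=1..q. B l) - (\<Sum>l=1..p. A l) > 0\<close>.
\<close>

definition fox_wright ::
  "nat \<Rightarrow> (nat \<Rightarrow> 'a) \<Rightarrow> (nat \<Rightarrow> real) \<Rightarrow> nat \<Rightarrow> (nat \<Rightarrow> 'a) \<Rightarrow> (nat \<Rightarrow> real) \<Rightarrow> 'a \<Rightarrow> 'a::Gamma"
where
  "fox_wright p \<alpha> A q \<beta> B z =
     (\<Sum>k. (\<Prod>l=1..p. Gamma (\<alpha> l + of_nat k * of_real (A l))) /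
          (\<Prod>l=1..q. Gamma (\<beta> l + of_nat k * of_real (B l))) * (z ^ k / fact k))"

end

theory Submission
  imports Defs "HOL-Real_Asymp.Real_Asymp"
begin

text \<open>
  Put \<open>x\<^sub>k = \<alpha>\<^sub>1 + k A\<^sub>1\<close> and let \<open>w\<^sub>k > 0\<close> be the \<open>k\<close>-th term of the series for
  \<open>\<Psi>(\<alpha>\<^sub>1; z)\<close>. By the functional equation of the Gamma function, raising the first parameter by 1
  or by 2 multiplies the \<open>k\<close>-th term by \<open>x\<^sub>k\<close> or by \<open>x\<^sub>k (x\<^sub>k + 1)\<close>. The claim therefore reads
  \<open>(\<Sum> w\<^sub>k) (\<Sum> w\<^sub>k x\<^sub>k (x\<^sub>k + 1)) > (\<Sum> w\<^sub>k x\<^sub>k)\<^sup>2\<close>, which is the Cauchy-Schwarz inequality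
  \<open>(\<Sum> w\<^sub>k) (\<Sum> w\<^sub>k x\<^sub>k\<^sup>2) \<ge> (\<Sum> w\<^sub>k x\<^sub>k)\<^sup>2\<close> with the positive surplus
  \<open>(\<Sum> w\<^sub>k) (\<Sum> w\<^sub>k x\<^sub>k)\<close>; this is lemma \<open>suminf_rising_moments_strict\<close>.

  The infinite sums mean what they should only if the three series converge, and this is where the
  condition on \<open>\<epsilon>\<close> enters. Log-convexity of the Gamma function squeezes \<open>\<Gamma>(x + a) / \<Gamma>(x)\<close> between
  \<open>(x - 1)\<^sup>a\<close> and \<open>(x + a)\<^sup>a\<close> for \<open>x > 1\<close>. Hence each Gamma factor with step \<open>a\<close> grows by a factor comparable
  to \<open>k\<^sup>a\<close> from index \<open>k\<close> to \<open>k + 1\<close>, and the quotient of consecutive terms of the series is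
  comparable to \<open>k\<close> to the power \<open>-\<epsilon>\<close>, so that the ratio test applies
  (lemma \<open>summable_fox_wright_terms\<close>).
\<close>

section \<open>Growth of the Gamma function along arithmetic progressions\<close>

text \<open>
  The chord of the convex function \<open>ln \<circ> Gamma\<close> over \<open>[x, x + a]\<close> is at least as steep as the one
  over \<open>[x - 1, x]\<close> and at most as steep as the one over \<open>[x + a, x + a + 1]\<close>. The functional
  equation gives the last two slopes: \<open>ln (x - 1)\<close> and \<open>ln (x + a)\<close>.
\<close>

lemma Gamma_quotient_bounds:
  fixes x a :: real
  assumes "x > 1" and "a > 0"
  shows "(x - 1) powr a \<le> Gamma (x + a) / Gamma x"
    and "Gamma (x + a) / Gamma x \<le> (x + a) powr a"
proof -
  define f :: "real \<Rightarrow> real" where "f = ln \<circ> Gamma"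
  have cvx: "convex_on {0<..} f"
    unfolding f_def by (rule log_convex_Gamma_real)
  have step: "f (y + 1) - f y = ln y" if "y > 0" for y
  proof -
    have "Gamma (y + 1) = y * Gamma y"
      using that by (intro Gamma_plus1) (auto elim!: nonpos_Ints_cases')
    then show ?thesis
      using that less_imp_neq[OF Gamma_real_pos[OF that], symmetric] by (simp add: f_def ln_mult)
  qed
  have eq: "Gamma (x + a) / Gamma x = exp (f (x + a) - f x)"
    using assms by (simp add: f_def exp_diff Gamma_real_pos)
  have slopes: "(f v - f u) / (v - u) \<le> (f w - f v) / (w - v)" if "0 < u" "u < v" "v < w" for u v w
    using convex_on_slope_le[OF cvx, of u w v] that
    by (smt (verit) divide_minus_right greaterThan_iff minus_diff_eq minus_divide_left)
  have "ln (x - 1) \<le> (f (x + a) - f x) / a"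
    using slopes[of "x - 1" x "x + a"] step[of "x - 1"] assms by simp
  then have "a * ln (x - 1) \<le> f (x + a) - f x"
    using assms by (simp add: field_simps)
  then show "(x - 1) powr a \<le> Gamma (x + a) / Gamma x"
    using assms by (simp add: eq powr_def)
  have "(f (x + a) - f x) / a \<le> ln (x + a)"
    using slopes[of x "x + a" "x + a + 1"] step[of "x + a"] assms by simp
  then have "f (x + a) - f x \<le> a * ln (x + a)"
    using assms by (simp add: field_simps)
  then show "Gamma (x + a) / Gamma x \<le> (x + a) powr a"
    using assms by (simp add: eq powr_def)
qed

text \<open>
  The limit is \<open>a\<^sup>a\<close>, with \<open>0\<^sup>0 = 1\<close>. As \<open>0 powr 0 = 0\<close>, it is stated as an unspecified positive
  number, which covers \<open>a = 0\<close> as well.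
\<close>

lemma Gamma_step_growth:
  fixes a c :: real
  assumes "a \<ge> 0" and "c > 0"
  shows "\<exists>L>0. (\<lambda>k. Gamma (c + real (Suc k) * a) / Gamma (c + real k * a) / real k powr a)
           \<longlonglongrightarrow> L"
proof (cases "a = 0")
  case True
  have "eventually (\<lambda>k. Gamma (c + real (Suc k) * a) / Gamma (c + real k * a) / real k powr a = 1)
      sequentially"
    using eventually_gt_at_top[of 0]
    by eventually_elim (use True less_imp_neq[OF Gamma_real_pos[OF assms(2)], symmetric] in simp)
  then show ?thesis
    by (intro exI[of _ 1]) (auto intro: tendsto_eventually)
next
  case False
  with assms have a: "a > 0" by simp
  have "filterlim (\<lambda>k. c + real k * a) at_top sequentially"
    using a by real_asymp
  then have large: "eventually (\<lambda>k. c + real k * a > 1) sequentially"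
    by (simp add: filterlim_at_top_dense)
  have bounds: "eventually (\<lambda>k.
      (c + real k * a - 1) powr a / real k powr a
        \<le> Gamma (c + real (Suc k) * a) / Gamma (c + real k * a) / real k powr a
    \<and> Gamma (c + real (Suc k) * a) / Gamma (c + real k * a) / real k powr a
        \<le> (c + real k * a + a) powr a / real k powr a) sequentially"
    using large
  proof eventually_elim
    case (elim k)
    have next_arg: "c + real (Suc k) * a = c + real k * a + a"
      by (simp add: algebra_simps)
    show ?case
      unfolding next_arg
      by (intro conjI divide_right_mono Gamma_quotient_bounds[OF elim a] powr_ge_zero)
  qed
  have lower: "(\<lambda>k. (c + real k * a - 1) powr a / real k powr a) \<longlonglongrightarrow> a powr a"
    using a by real_asymp
  have upper: "(\<lambda>k. (c + real k * a + a) powr a / real k powr a) \<longlonglongrightarrow> a powr a"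
    using a by real_asymp
  have "(\<lambda>k. Gamma (c + real (Suc k) * a) / Gamma (c + real k * a) / real k powr a)
      \<longlonglongrightarrow> a powr a"
    using bounds by (intro tendsto_sandwich[OF _ _ lower upper]) (simp_all only: eventually_conj_iff)
  then show ?thesis
    using a by (intro exI[of _ "a powr a"]) simp
qed

lemma prod_Gamma_step_growth:
  fixes a c :: "'i \<Rightarrow> real"
  assumes "finite I" and "\<And>i. i \<in> I \<Longrightarrow> a i \<ge> 0" and "\<And>i. i \<in> I \<Longrightarrow> c i > 0"
  shows "\<exists>L>0. (\<lambda>k. (\<Prod>i\<in>I. Gamma (c i + real (Suc k) * a i)) /
             (\<Prod>i\<in>I. Gamma (c i + real k * a i)) / real k powr (\<Sum>i\<in>I. a i)) \<longlonglongrightarrow> L"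
proof -
  define R where
    "R = (\<lambda>i k. Gamma (c i + real (Suc k) * a i) / Gamma (c i + real k * a i) / real k powr a i)"
  have "\<forall>i\<in>I. \<exists>L>0. R i \<longlonglongrightarrow> L"
    using Gamma_step_growth assms unfolding R_def by blast
  then obtain L where L: "\<And>i. i \<in> I \<Longrightarrow> L i > 0" "\<And>i. i \<in> I \<Longrightarrow> R i \<longlonglongrightarrow> L i"
    by metis
  have "(\<lambda>k. \<Prod>i\<in>I. R i k) \<longlonglongrightarrow> (\<Prod>i\<in>I. L i)"
    using L by (intro tendsto_prod) auto
  moreover have "eventually (\<lambda>k. (\<Prod>i\<in>I. R i k) =
      (\<Prod>i\<in>I. Gamma (c i + real (Suc k) * a i)) /
      (\<Prod>i\<in>I. Gamma (c i + real k * a i)) / real k powr (\<Sum>i\<in>I. a i)) sequentially"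
    using eventually_gt_at_top[of 0]
    by eventually_elim (simp add: R_def prod_dividef prod.distrib powr_sum)
  ultimately have "(\<lambda>k. (\<Prod>i\<in>I. Gamma (c i + real (Suc k) * a i)) /
      (\<Prod>i\<in>I. Gamma (c i + real k * a i)) / real k powr (\<Sum>i\<in>I. a i)) \<longlonglongrightarrow> (\<Prod>i\<in>I. L i)"
    by (rule Lim_transform_eventually)
  then show ?thesis
    using L by (intro exI[of _ "\<Prod>i\<in>I. L i"]) (simp add: prod_pos)
qed

section \<open>Convergence of the Fox-Wright series\<close>

lemma summable_if_ratio_tendsto_0:
  fixes t :: "nat \<Rightarrow> real"
  assumes "\<And>k. t k > 0" and "(\<lambda>k. t (Suc k) / t k) \<longlonglongrightarrow> 0"
  shows "summable t"
proof -
  have "eventually (\<lambda>k. t (Suc k) / t k < 1/2) sequentially"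
    using assms(2) by (rule order_tendstoD) simp
  then obtain N where N: "\<And>k. k \<ge> N \<Longrightarrow> t (Suc k) / t k < 1/2"
    by (auto simp: eventually_at_top_linorder)
  show ?thesis
  proof (rule summable_ratio_test[of "1/2" N])
    fix k assume "k \<ge> N"
    then show "norm (t (Suc k)) \<le> 1/2 * norm (t k)"
      using N[of k] assms(1)[of k] assms(1)[of "Suc k"] by (simp add: field_simps)
  qed simp
qed

lemma fox_wright_term_pos:
  fixes \<alpha> \<beta> A B :: "nat \<Rightarrow> real" and z :: real
  assumes "\<And>l. l \<in> {1..p} \<Longrightarrow> \<alpha> l > 0" and "\<And>l. l \<in> {1..q} \<Longrightarrow> \<beta> l > 0"
    and "\<And>l. l \<in> {1..p} \<Longrightarrow> A l \<ge> 0" and "\<And>l. l \<in> {1..q} \<Longrightarrow> B l \<ge> 0"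
    and "z > 0"
  shows "(\<Prod>l=1..p. Gamma (\<alpha> l + real k * A l)) / (\<Prod>l=1..q. Gamma (\<beta> l + real k * B l))
           * (z ^ k / fact k) > 0"
  using assms
  by (intro mult_pos_pos divide_pos_pos prod_pos Gamma_real_pos add_pos_nonneg mult_nonneg_nonneg
      zero_less_power) auto

text \<open>
  The quotient of consecutive terms is asymptotically a constant times
  \<open>k\<^sup>s z / (k + 1)\<close>, where \<open>s\<close> is the sum of all \<open>A l\<close> minus the sum of all \<open>B l\<close>, and \<open>s < 1\<close>
  makes it tend to 0.
\<close>

lemma summable_fox_wright_terms:
  fixes \<alpha> \<beta> A B :: "nat \<Rightarrow> real" and z :: real
  assumes \<alpha>: "\<And>l. l \<in> {1..p} \<Longrightarrow> \<alpha> l > 0" and \<beta>: "\<And>l. l \<in> {1..q} \<Longrightarrow> \<beta> l > 0"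
    and A: "\<And>l. l \<in> {1..p} \<Longrightarrow> A l \<ge> 0" and B: "\<And>l. l \<in> {1..q} \<Longrightarrow> B l \<ge> 0"
    and eps: "1 + (\<Sum>l=1..q. B l) - (\<Sum>l=1..p. A l) > 0"
    and z: "z > 0"
  shows "summable (\<lambda>k. (\<Prod>l=1..p. Gamma (\<alpha> l + real k * A l)) /
           (\<Prod>l=1..q. Gamma (\<beta> l + real k * B l)) * (z ^ k / fact k))"
proof -
  define P where "P = (\<lambda>k. \<Prod>l=1..p. Gamma (\<alpha> l + real k * A l))"
  define Q where "Q = (\<lambda>k. \<Prod>l=1..q. Gamma (\<beta> l + real k * B l))"
  define s where "s = (\<Sum>l=1..p. A l)"
  define r where "r = (\<Sum>l=1..q. B l)"
  define t where "t = (\<lambda>k. P k / Q k * (z ^ k / fact k))"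
  have t_pos: "t k > 0" for k
    unfolding t_def P_def Q_def using fox_wright_term_pos \<alpha> \<beta> A B z by blast
  obtain L where L: "(\<lambda>k. P (Suc k) / P k / real k powr s) \<longlonglongrightarrow> L"
    using prod_Gamma_step_growth[of "{1..p}" A \<alpha>] \<alpha> A unfolding P_def s_def by auto
  obtain M where M: "M > 0" "(\<lambda>k. Q (Suc k) / Q k / real k powr r) \<longlonglongrightarrow> M"
    using prod_Gamma_step_growth[of "{1..q}" B \<beta>] \<beta> B unfolding Q_def r_def by auto
  have "s - r < 1"
    using eps by (simp add: s_def r_def)
  then have "(\<lambda>k. real k powr (s - r) * (z / real (Suc k))) \<longlonglongrightarrow> 0"
    by real_asymp
  then have "(\<lambda>k. (P (Suc k) / P k / real k powr s) / (Q (Suc k) / Q k / real k powr r)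
      * (real k powr (s - r) * (z / real (Suc k)))) \<longlonglongrightarrow> L / M * 0"
    using L M by (intro tendsto_mult tendsto_divide) auto
  moreover have "eventually (\<lambda>k.
      (P (Suc k) / P k / real k powr s) / (Q (Suc k) / Q k / real k powr r)
        * (real k powr (s - r) * (z / real (Suc k))) = t (Suc k) / t k) sequentially"
    using eventually_gt_at_top[of 0]
  proof eventually_elim
    case (elim k)
    have "fact (Suc k) = real (Suc k) * fact k"
      by simp
    then show ?case
      using elim z t_pos[of k] t_pos[of "Suc k"]
      by (simp add: t_def powr_diff divide_simps del: fact_Suc of_nat_Suc)
  qed
  ultimately have "(\<lambda>k. t (Suc k) / t k) \<longlonglongrightarrow> 0"
    by (auto dest: Lim_transform_eventually)
  then have "summable t"
    using t_pos by (rule summable_if_ratio_tendsto_0[rotated])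
  then show ?thesis
    by (simp add: t_def P_def Q_def)
qed

section \<open>The Turan inequality\<close>

text \<open>
  With \<open>S0\<close>, \<open>S1\<close>, \<open>S2\<close> the three sums and \<open>m = S1 / S0\<close> the mean of \<open>x\<close>, the nonnegative
  sum of \<open>w k * (x k - m)\<^sup>2\<close> equals \<open>S2 - S1 - S1\<^sup>2 / S0\<close>; hence \<open>S0 * S2 \<ge> S1\<^sup>2 + S0 * S1\<close>.
  Strictness comes from \<open>S0 * S1 > 0\<close>, so it persists when all \<open>x k\<close> coincide.
\<close>

lemma suminf_rising_moments_strict:
  fixes w x :: "nat \<Rightarrow> real"
  assumes w: "\<And>k. w k > 0" and x: "\<And>k. x k > 0"
    and s0: "summable w" and s1: "summable (\<lambda>k. w k * x k)"
    and s2: "summable (\<lambda>k. w k * (x k * (x k + 1)))"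
  shows "(\<Sum>k. w k * x k)\<^sup>2 < (\<Sum>k. w k) * (\<Sum>k. w k * (x k * (x k + 1)))"
proof -
  define S0 S1 S2 where "S0 = (\<Sum>k. w k)" and "S1 = (\<Sum>k. w k * x k)"
    and "S2 = (\<Sum>k. w k * (x k * (x k + 1)))"
  define m where "m = S1 / S0"
  have pos: "S0 > 0" "S1 > 0"
    unfolding S0_def S1_def using w x s0 s1 by (auto intro!: suminf_pos)
  have "(\<lambda>k. w k * (x k * (x k + 1)) - w k * x k - 2 * m * (w k * x k) + m\<^sup>2 * w k)
      sums (S2 - S1 - 2 * m * S1 + m\<^sup>2 * S0)"
    unfolding S0_def S1_def S2_def using s0 s1 s2
    by (intro sums_add sums_diff sums_mult summable_sums)
  moreover have "w k * (x k * (x k + 1)) - w k * x k - 2 * m * (w k * x k) + m\<^sup>2 * w k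
      = w k * (x k - m)\<^sup>2" for k
    by (simp add: power2_eq_square algebra_simps)
  ultimately have "(\<lambda>k. w k * (x k - m)\<^sup>2) sums (S2 - S1 - 2 * m * S1 + m\<^sup>2 * S0)"
    by simp
  then have "0 \<le> S2 - S1 - 2 * m * S1 + m\<^sup>2 * S0"
    by (rule sums_le[OF _ sums_zero, rotated]) (simp add: w less_imp_le)
  also have "\<dots> = S2 - S1 - S1\<^sup>2 / S0"
    using pos by (simp add: m_def power2_eq_square field_simps)
  finally have "S1\<^sup>2 + S0 * S1 \<le> S0 * S2"
    using pos by (simp add: field_simps)
  moreover have "S0 * S1 > 0"
    using pos by simp
  ultimately show ?thesis
    by (simp add: S0_def S1_def S2_def)
qed

theorem theorem1:
  fixes p q :: nat and \<alpha> \<beta> A B :: "nat \<Rightarrow> real" and z :: real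
  assumes "p \<ge> 1"
    and "\<And>l. l \<in> {1..p} \<Longrightarrow> \<alpha> l > 0"
    and "\<And>l. l \<in> {1..q} \<Longrightarrow> \<beta> l > 0"
    and "\<And>l. l \<in> {1..p} \<Longrightarrow> A l \<ge> 0"
    and "\<And>l. l \<in> {1..q} \<Longrightarrow> B l \<ge> 0"
    and "1 + (\<Sum>l=1..q. B l) - (\<Sum>l=1..p. A l) > 0"
    and "z \<in> {0<..}"
  shows "let \<Psi> = (\<lambda>a. fox_wright p (\<alpha>(1 := a)) A q \<beta> B)
         in \<Psi> (\<alpha> 1) z * \<Psi> (\<alpha> 1 + 2) z - (\<Psi> (\<alpha> 1 + 1) z)\<^sup>2 > 0"
proof -
  define T where "T = (\<lambda>a k. (\<Prod>l=1..p. Gamma ((\<alpha>(1 := a)) l + real k * A l)) /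
      (\<Prod>l=1..q. Gamma (\<beta> l + real k * B l)) * (z ^ k / fact k))"
  define x where "x = (\<lambda>k. \<alpha> 1 + real k * A 1)"
  have z: "z > 0" and \<alpha>1: "\<alpha> 1 > 0" and A1: "A 1 \<ge> 0"
    using assms by auto
  have \<Psi>: "fox_wright p (\<alpha>(1 := a)) A q \<beta> B z = (\<Sum>k. T a k)" for a
    by (simp add: fox_wright_def T_def)
  have T_pos: "T a k > 0" and T_summable: "summable (T a)" if "a > 0" for a k
  proof -
    have pos: "(\<alpha>(1 := a)) l > 0" if "l \<in> {1..p}" for l
      using assms(2) \<open>a > 0\<close> that by auto
    show "T a k > 0"
      unfolding T_def by (rule fox_wright_term_pos[OF pos assms(3-5) z])
    show "summable (T a)"
      unfolding T_def by (rule summable_fox_wright_terms[OF pos assms(3-6) z])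
  qed
  have x_pos: "x k > 0" for k
    unfolding x_def using \<alpha>1 A1 by (intro add_pos_nonneg) auto
  have T_shift: "T (a + 1) k = T a k * (a + real k * A 1)" if "a > 0" for a k
  proof -
    have split: "(\<Prod>l=1..p. Gamma ((\<alpha>(1 := b)) l + real k * A l)) =
        Gamma (b + real k * A 1) * (\<Prod>l\<in>{1..p} - {1}. Gamma (\<alpha> l + real k * A l))" for b
      using \<open>p \<ge> 1\<close> by (subst prod.remove[of _ 1]) (auto intro!: prod.cong)
    have "a + real k * A 1 > 0"
      using that A1 by (intro add_pos_nonneg) auto
    then have "Gamma (a + real k * A 1 + 1) = (a + real k * A 1) * Gamma (a + real k * A 1)"
      by (intro Gamma_plus1) (auto elim!: nonpos_Ints_cases')
    then have "Gamma (a + 1 + real k * A 1) = (a + real k * A 1) * Gamma (a + real k * A 1)"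
      by (simp add: algebra_simps)
    then show ?thesis
      unfolding T_def split by simp
  qed
  have T1: "T (\<alpha> 1 + 1) = (\<lambda>k. T (\<alpha> 1) k * x k)"
    using T_shift[OF \<alpha>1] by (simp add: x_def fun_eq_iff)
  have T2: "T (\<alpha> 1 + 2) = (\<lambda>k. T (\<alpha> 1) k * (x k * (x k + 1)))"
  proof
    fix k
    have "T (\<alpha> 1 + 2) k = T (\<alpha> 1 + 1) k * (x k + 1)"
      using T_shift[of "\<alpha> 1 + 1" k] \<alpha>1 by (simp add: x_def algebra_simps)
    then show "T (\<alpha> 1 + 2) k = T (\<alpha> 1) k * (x k * (x k + 1))"
      unfolding T1 by (simp only: mult.assoc)
  qed
  have "(\<Sum>k. T (\<alpha> 1) k * x k)\<^sup>2 < (\<Sum>k. T (\<alpha> 1) k) * (\<Sum>k. T (\<alpha> 1) k * (x k * (x k + 1)))"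
  proof (rule suminf_rising_moments_strict)
    show "summable (\<lambda>k. T (\<alpha> 1) k * x k)" "summable (\<lambda>k. T (\<alpha> 1) k * (x k * (x k + 1)))"
      using T_summable[of "\<alpha> 1 + 1"] T_summable[of "\<alpha> 1 + 2"] \<alpha>1 unfolding T1 T2 by auto
  qed (use T_pos T_summable x_pos \<alpha>1 in auto)
  then show ?thesis
    unfolding Let_def \<Psi> T1 T2 by simp
qed

end
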